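(* Let $X$ be a nonempty set, $d\in\mathbb{N}$, let $K:X\times X\to\mathbb{R}$ be a scalar-valued positive definite kernel, let $\mathbb{A}$ be a $d\times d$ strictly positive definite symmetric real matrix, and define $\mathbf{K}(x,x')=K(x,x')\mathbb{A}$ for $x,x'\in X$. Then $\mathbf{K}$ is an admissible multi-task kernel if and only if $K$ is an admissible single-task kernel.
   Context: $\mathbb{N}=\{1,2,\dots\}$. A scalar-valued positive definite kernel is, as usual for reproducing kernels, a symmetric function $K:X\times X\to\mathbb{R}$ such that all matrices $[K(x_j,x_k)]_{j,k=1}^m$ with $x_j\in X$ are positive semi-definite. For a vector, $\|\cdot\|_1$ is the $\ell^1$ norm; for a matrix, $\|\cdot\|_1$ is the $\ell^1$-induced operator norm. $\ell^1_d(\mathbb{N})$ is the space of sequences $(\boldsymbol{c}_j)_{j\in\mathbb{N}}$ in $\mathbb{R}^d$ with $\sum_j\|\boldsymbol{c}_j\|_1<\infty$. Admissible multi-task kernel: a function $\mathbf{K}:X\times X\to\mathbb{R}^{d\times d}$ with $\mathbf{K}(x,x')^\top=\mathbf{K}(x,x')$ for all $x,x'\in X$ such that (A1) for all $m\in\mathbb{N}$ and pairwise distinct $x_1,\dots,x_m\in X$, the $md\times md$ block matrix $\mathbf{K}[\mathbf{x}]$ whose $(j,k)$ block is $\mathbf{K}(x_k,x_j)$ is non-singular; (A2) there is $\kappa>0$ with $\|\mathbf{K}(x,x')\|_1\le\kappa$ for all $x,x'\in X$; (A3) for all pairwise distinct $x_j\in X$, $j\in\mathbb{N}$, and $(\boldsymbol{c}_j)_{j\in\mathbb{N}}\in\ell^1_d(\mathbb{N})$,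 if $\sum_{j\in\mathbb{N}}\mathbf{K}(x_j,x)\boldsymbol{c}_j=0$ for all $x\in X$, then $\boldsymbol{c}_j=0$ for all $j$. An admissible single-task kernel is a function $K:X\times X\to\mathbb{R}$ satisfying these conditions with $d=1$. *)

theory Defs
  imports Complex_Main "Jordan_Normal_Form.Matrix"
begin

definition vec_l1_norm :: "real vec \<Rightarrow> real" where
  "vec_l1_norm v = (\<Sum>i<dim_vec v. \<bar>v $ i\<bar>)"

definition mat_l1_norm :: "real mat \<Rightarrow> real" where
  "mat_l1_norm M =
     (SUP v \<in> {v \<in> carrier_vec (dim_col M). vec_l1_norm v \<le> 1}. vec_l1_norm (M *\<^sub>v v))"

text \<open>The type of vectors carries no topology; convergence of a series in dimension \<open>d\<close>
  is convergence of all \<open>d\<close> coordinate series.\<close>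

definition vec_sums :: "nat \<Rightarrow> (nat \<Rightarrow> real vec) \<Rightarrow> real vec \<Rightarrow> bool" where
  "vec_sums d f s \<longleftrightarrow>
     (\<forall>j. f j \<in> carrier_vec d) \<and> s \<in> carrier_vec d \<and> (\<forall>i<d. (\<lambda>j. f j $ i) sums (s $ i))"

definition l1_seq :: "nat \<Rightarrow> (nat \<Rightarrow> real vec) set" where
  "l1_seq d = {c. (\<forall>j. c j \<in> carrier_vec d) \<and> summable (\<lambda>j. vec_l1_norm (c j))}"

definition symmetric_mat :: "real mat \<Rightarrow> bool" where
  "symmetric_mat M \<longleftrightarrow> transpose_mat M = M"

definition pos_semidef_mat :: "real mat \<Rightarrow> bool" where
  "pos_semidef_mat M \<longleftrightarrow> square_mat M \<and> symmetric_mat M \<and>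
     (\<forall>v \<in> carrier_vec (dim_row M). 0 \<le> v \<bullet> (M *\<^sub>v v))"

definition strict_pos_def_mat :: "real mat \<Rightarrow> bool" where
  "strict_pos_def_mat M \<longleftrightarrow> square_mat M \<and>
     (\<forall>v \<in> carrier_vec (dim_row M). v \<noteq> 0\<^sub>v (dim_row M) \<longrightarrow> 0 < v \<bullet> (M *\<^sub>v v))"

text \<open>The points \<open>x j\<close> need not be distinct.\<close>

definition pos_def_kernel :: "'a set \<Rightarrow> ('a \<Rightarrow> 'a \<Rightarrow> real) \<Rightarrow> bool" where
  "pos_def_kernel X K \<longleftrightarrow>
     (\<forall>x\<in>X. \<forall>x'\<in>X. K x x' = K x' x) \<and>
     (\<forall>(m::nat) x. 1 \<le> m \<longrightarrow> (\<forall>j<m. x j \<in> X) \<longrightarrow>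
        pos_semidef_mat (mat m m (\<lambda>(j, k). K (x j) (x k))))"

text \<open>The \<open>md \<times> md\<close> matrix whose \<open>d \<times> d\<close> block in block row \<open>j\<close> and block column \<open>k\<close> is
  \<open>K (x k) (x j)\<close>; note the order of the arguments. Points are indexed by \<open>0, ..., m - 1\<close>.\<close>

definition kernel_block_mat ::
    "nat \<Rightarrow> ('a \<Rightarrow> 'a \<Rightarrow> real mat) \<Rightarrow> nat \<Rightarrow> (nat \<Rightarrow> 'a) \<Rightarrow> real mat" where
  "kernel_block_mat d K m x =
     mat (m * d) (m * d) (\<lambda>(r, s). K (x (s div d)) (x (r div d)) $$ (r mod d, s mod d))"

definition admissible_multi_task_kernel ::
    "nat \<Rightarrow> 'a set \<Rightarrow> ('a \<Rightarrow> 'a \<Rightarrow> real mat) \<Rightarrow> bool" where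
  "admissible_multi_task_kernel d X K \<longleftrightarrow>
     (\<forall>x\<in>X. \<forall>x'\<in>X. K x x' \<in> carrier_mat d d \<and> symmetric_mat (K x x')) \<and>
     (\<forall>(m::nat) x. 1 \<le> m \<longrightarrow> (\<forall>j<m. x j \<in> X) \<longrightarrow> inj_on x {..<m} \<longrightarrow>
        invertible_mat (kernel_block_mat d K m x)) \<and>
     (\<exists>\<kappa>>0. \<forall>x\<in>X. \<forall>x'\<in>X. mat_l1_norm (K x x') \<le> \<kappa>) \<and>
     (\<forall>(x::nat \<Rightarrow> 'a) c. (\<forall>j. x j \<in> X) \<longrightarrow> inj x \<longrightarrow> c \<in> l1_seq d \<longrightarrow>
        (\<forall>y\<in>X. vec_sums d (\<lambda>j. K (x j) y *\<^sub>v c j) (0\<^sub>v d)) \<longrightarrow>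
        (\<forall>j. c j = 0\<^sub>v d))"

definition admissible_single_task_kernel :: "'a set \<Rightarrow> ('a \<Rightarrow> 'a \<Rightarrow> real) \<Rightarrow> bool" where
  "admissible_single_task_kernel X K \<longleftrightarrow>
     admissible_multi_task_kernel 1 X (\<lambda>x x'. mat 1 1 (\<lambda>_. K x x'))"

end

theory Submission
  imports Defs "Jordan_Normal_Form.Determinant"
begin

text \<open>If \<open>A\<close> has trivial kernel, admissibility of \<open>K \<cdot> A\<close> reduces to three conditions on \<open>K\<close> alone:
  the block matrix is the Kronecker product of the Gram matrix with \<open>A\<close>, the norms of
  \<open>K(x,x') \<cdot> A\<close> are comparable to \<open>\<bar>K(x,x')\<bar>\<close>, and (A3) can be read off coordinatewise from the
  sequences \<open>A c\<^sub>j\<close>, respectively tested on multiples of a fixed vector. The single-task case is the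
  instance \<open>A = (1)\<close>, so both sides of the equivalence reduce to the same conditions.\<close>

section \<open>Invertibility of a square matrix as triviality of its kernel\<close>

lemma index_mult_mat_vec_sum:
  assumes "M \<in> carrier_mat n m" "v \<in> carrier_vec m" "i < n"
  shows "(M *\<^sub>v v) $ i = (\<Sum>j<m. M $$ (i, j) * v $ j)"
  using assms by (auto simp: scalar_prod_def atLeast0LessThan intro!: sum.cong)

lemma mult_mat_vec_eq_0_iff:
  fixes M :: "'b :: comm_ring_1 mat"
  assumes "M \<in> carrier_mat n m" "v \<in> carrier_vec m"
  shows "M *\<^sub>v v = 0\<^sub>v n \<longleftrightarrow> (\<forall>i<n. (\<Sum>j<m. M $$ (i, j) * v $ j) = 0)"
  using assms index_mult_mat_vec_sum[OF assms] by (auto simp: vec_eq_iff)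

text \<open>A left inverse sends a null vector back to itself and also to zero. Conversely, over a
  field a vanishing determinant would produce a nonzero null vector, and a matrix with nonzero
  determinant is a unit of the matrix ring.\<close>

lemma invertible_mat_iff_trivial_kernel:
  fixes M :: "'b :: field mat"
  assumes "M \<in> carrier_mat n n"
  shows "invertible_mat M \<longleftrightarrow> (\<forall>v \<in> carrier_vec n. M *\<^sub>v v = 0\<^sub>v n \<longrightarrow> v = 0\<^sub>v n)"
proof
  assume "invertible_mat M"
  then obtain B where B: "M * B = 1\<^sub>m (dim_row M)" "B * M = 1\<^sub>m (dim_row B)"
    by (auto simp: invertible_mat_def inverts_mat_def)
  \<comment> \<open>\<open>invertible_mat\<close> does not state the format of \<open>B\<close>;
    comparing the column counts in the two product equations forces it to be \<open>n\<close> by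
    \<open>n\<close>.\<close>
  have Bc: "B \<in> carrier_mat n n"
    using arg_cong[OF B(1), of dim_col] arg_cong[OF B(2), of dim_col] assms by auto
  show "\<forall>v \<in> carrier_vec n. M *\<^sub>v v = 0\<^sub>v n \<longrightarrow> v = 0\<^sub>v n"
  proof (intro ballI impI)
    fix v :: "'b vec" assume v: "v \<in> carrier_vec n" "M *\<^sub>v v = 0\<^sub>v n"
    have "v = (B * M) *\<^sub>v v" using B Bc v by simp
    also have "\<dots> = 0\<^sub>v n" using Bc assms v by (simp add: assoc_mult_mat_vec[of _ n n _ n], intro eq_vecI) auto
    finally show "v = 0\<^sub>v n" .
  qed
next
  assume "\<forall>v \<in> carrier_vec n. M *\<^sub>v v = 0\<^sub>v n \<longrightarrow> v = 0\<^sub>v n"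
  then have "det M \<noteq> 0"
    using det_0_iff_vec_prod_zero_field[OF assms] by blast
  then have "M \<in> Units (ring_mat TYPE('b) n ())"
    by (rule det_non_zero_imp_unit[OF assms])
  then show "invertible_mat M"
    using assms by (auto simp: Units_def ring_mat_def invertible_mat_def inverts_mat_def)
qed

lemma smult_mat_mult_vec:
  fixes A :: "'b :: comm_ring_1 mat"
  assumes "A \<in> carrier_mat n m" "v \<in> carrier_vec m"
  shows "(k \<cdot>\<^sub>m A) *\<^sub>v v = k \<cdot>\<^sub>v (A *\<^sub>v v)"
  using assms by (intro eq_vecI) auto

text \<open>Null vectors become plain functions on indices, so that they can be regrouped into
  blocks by index arithmetic.\<close>

lemma invertible_mat_iff_sum:
  fixes M :: "'b :: field mat"
  assumes M: "M \<in> carrier_mat n n"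
  shows "invertible_mat M \<longleftrightarrow>
    (\<forall>f. (\<forall>i<n. (\<Sum>j<n. M $$ (i, j) * f j) = 0) \<longrightarrow> (\<forall>i<n. f i = 0))" (is "_ \<longleftrightarrow> ?R")
proof
  assume inv: "invertible_mat M"
  show ?R
  proof (intro allI impI)
    fix f i assume f: "\<forall>i<n. (\<Sum>j<n. M $$ (i, j) * f j) = 0" and i: "i < n"
    have "M *\<^sub>v vec n f = 0\<^sub>v n"
      using f by (subst mult_mat_vec_eq_0_iff[OF M]) auto
    then have "vec n f = 0\<^sub>v n"
      using inv invertible_mat_iff_trivial_kernel[OF M] by auto
    then show "f i = 0"
      using i by (metis index_vec index_zero_vec(1))
  qed
next
  assume R: ?R
  have "v = 0\<^sub>v n" if v: "v \<in> carrier_vec n" "M *\<^sub>v v = 0\<^sub>v n" for v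
    using R v mult_mat_vec_eq_0_iff[OF M v(1)] by (auto simp: vec_eq_iff)
  then show "invertible_mat M"
    using invertible_mat_iff_trivial_kernel[OF M] by blast
qed

section \<open>Kronecker products and condition (A1)\<close>

lemma sum_lessThan_mult:
  fixes f :: "nat \<Rightarrow> 'b :: comm_monoid_add"
  shows "(\<Sum>s<m * d. f s) = (\<Sum>k<m. \<Sum>l<d. f (k * d + l))"
proof -
  have "sum f {k * d..<k * d + d} = (\<Sum>l<d. f (k * d + l))" for k
    using sum.shift_bounds_nat_ivl[of f 0 "k * d" d]
    by (simp add: atLeast0LessThan add.commute)
  then show ?thesis
    by (simp flip: sum.nat_group)
qed

definition kronecker_mat :: "'b :: semiring_0 mat \<Rightarrow> 'b mat \<Rightarrow> 'b mat" where
  "kronecker_mat G A = mat (dim_row G * dim_row A) (dim_col G * dim_col A)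
     (\<lambda>(r, s). G $$ (r div dim_row A, s div dim_col A) * A $$ (r mod dim_row A, s mod dim_col A))"

lemma kronecker_mat_carrier:
  "G \<in> carrier_mat m m \<Longrightarrow> A \<in> carrier_mat d d \<Longrightarrow> kronecker_mat G A \<in> carrier_mat (m * d) (m * d)"
  by (auto simp: kronecker_mat_def)

lemma mult_add_less_mult:
  fixes j i :: nat
  assumes "j < m" "i < d"
  shows "j * d + i < m * d"
proof -
  have "j * d + i < Suc j * d" using assms by simp
  also have "\<dots> \<le> m * d" using assms by (intro mult_le_mono1) simp
  finally show ?thesis .
qed

text \<open>The product acts by applying \<open>A\<close> inside each block of \<open>f\<close> and
  then \<open>G\<close> across the blocks.\<close>

lemma kronecker_mat_sum:
  fixes A :: "'b :: comm_semiring_0 mat"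
  assumes "G \<in> carrier_mat m m" "A \<in> carrier_mat d d" "j < m" "i < d"
  shows "(\<Sum>s<m * d. kronecker_mat G A $$ (j * d + i, s) * f s) =
    (\<Sum>k<m. G $$ (j, k) * (\<Sum>l<d. A $$ (i, l) * f (k * d + l)))"
  using assms
  by (auto simp: sum_lessThan_mult kronecker_mat_def mult_add_less_mult sum_distrib_left mult.assoc
      intro!: sum.cong)

text \<open>A null vector of \<open>G\<close>, repeated along each block, is a null vector of the
  product. Conversely, a null vector of the product is annihilated by first removing
  \<open>G\<close> across blocks and then \<open>A\<close> within each block. For
  \<open>d = 0\<close> the product would be the empty matrix, which is invertible whatever
  \<open>G\<close> is.\<close>

lemma invertible_kronecker_mat_iff:
  fixes A :: "'b :: field mat"
  assumes G: "G \<in> carrier_mat m m" and A: "A \<in> carrier_mat d d"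
    and invA: "invertible_mat A" and d: "0 < d"
  shows "invertible_mat (kronecker_mat G A) \<longleftrightarrow> invertible_mat G"
proof
  assume inv: "invertible_mat (kronecker_mat G A)"
  show "invertible_mat G"
  proof (subst invertible_mat_iff_sum[OF G], intro allI impI)
    fix f i assume f: "\<forall>i<m. (\<Sum>j<m. G $$ (i, j) * f j) = 0" and i: "i < m"
    \<comment> \<open>The test vector is constant on blocks, so the sum factors into a row sum of
      \<open>A\<close> and an entry of \<open>G\<close> applied to \<open>f\<close>.\<close>
    have "(\<Sum>s<m * d. kronecker_mat G A $$ (r, s) * f (s div d)) = 0" if r: "r < m * d" for r
    proof -
      have rd: "r div d < m" "r mod d < d"
        using r d by (auto simp: less_mult_imp_div_less)
      have "(\<Sum>k<m. G $$ (r div d, k) * (\<Sum>l<d. A $$ (r mod d, l) * f ((k * d + l) div d)))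
          = (\<Sum>l<d. A $$ (r mod d, l)) * (\<Sum>k<m. G $$ (r div d, k) * f k)"
        by (auto simp: sum_distrib_left sum_distrib_right mult_ac intro!: sum.cong)
      also have "\<dots> = 0" using f rd by simp
      finally show ?thesis
        using kronecker_mat_sum[OF G A rd, of "\<lambda>s. f (s div d)"] by simp
    qed
    then have "f ((i * d + 0) div d) = 0"
      by (rule invertible_mat_iff_sum[THEN iffD1, rule_format, OF kronecker_mat_carrier[OF G A] inv _
            mult_add_less_mult[OF i d], of "\<lambda>s. f (s div d)"])
    then show "f i = 0" using d by simp
  qed
next
  assume inv: "invertible_mat G"
  show "invertible_mat (kronecker_mat G A)"
  proof (subst invertible_mat_iff_sum[OF kronecker_mat_carrier[OF G A]], intro allI impI)
    fix f r
    assume f: "\<forall>i<m * d. (\<Sum>j<m * d. kronecker_mat G A $$ (i, j) * f j) = 0" and r: "r < m * d"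
    have "(\<Sum>k<m. G $$ (j, k) * (\<Sum>l<d. A $$ (i, l) * f (k * d + l))) = 0"
      if "j < m" "i < d" for i j
      using kronecker_mat_sum[OF G A that, of f] f mult_add_less_mult[OF that] by simp
    \<comment> \<open>For fixed \<open>i\<close>, these inner sums form, as a function of the block
      number \<open>k\<close>, a null vector of \<open>G\<close>.\<close>
    then have "(\<Sum>l<d. A $$ (i, l) * f (k * d + l)) = 0" if "k < m" "i < d" for k i
      using that
      by (intro invertible_mat_iff_sum[THEN iffD1, rule_format, OF G inv,
            of "\<lambda>k. \<Sum>l<d. A $$ (i, l) * f (k * d + l)"])
    then have "f (k * d + l) = 0" if "k < m" "l < d" for k l
      using that
      by (intro invertible_mat_iff_sum[THEN iffD1, rule_format, OF A invA,
            of "\<lambda>l. f (k * d + l)"])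
    from this[of "r div d" "r mod d"] show "f r = 0"
      using r d by (simp add: less_mult_imp_div_less)
  qed
qed

text \<open>The Gram matrix keeps the swapped argument order of \<open>kernel_block_mat\<close>, so
  every choice of \<open>A\<close> leads to the same scalar matrix.\<close>

lemma kernel_block_mat_smult:
  assumes "A \<in> carrier_mat d d" "0 < d"
  shows "kernel_block_mat d (\<lambda>x x'. K x x' \<cdot>\<^sub>m A) m x =
    kronecker_mat (mat m m (\<lambda>(j, k). K (x k) (x j))) A"
  using assms
  by (intro eq_matI) (auto simp: kernel_block_mat_def kronecker_mat_def less_mult_imp_div_less)

section \<open>The l1 norms and condition (A2)\<close>

lemma abs_index_le_vec_l1_norm: "i < dim_vec v \<Longrightarrow> \<bar>v $ i\<bar> \<le> vec_l1_norm v"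
  unfolding vec_l1_norm_def by (rule member_le_sum) auto

lemma vec_l1_norm_smult: "vec_l1_norm (k \<cdot>\<^sub>v v) = \<bar>k\<bar> * vec_l1_norm v"
  by (simp add: vec_l1_norm_def abs_mult sum_distrib_left)

lemma vec_l1_norm_pos:
  assumes "v \<in> carrier_vec n" "v \<noteq> 0\<^sub>v n"
  shows "0 < vec_l1_norm v"
proof -
  obtain i where "i < dim_vec v" "v $ i \<noteq> 0"
    using assms by (auto simp: vec_eq_iff)
  then show ?thesis using abs_index_le_vec_l1_norm[of i v] by simp
qed

text \<open>Used twice: to bound the operator norm, and to show that the coordinates of
  \<open>A\<close> applied to an l1 sequence are absolutely summable.\<close>

lemma abs_index_mult_mat_vec_le:
  assumes M: "M \<in> carrier_mat n m" and v: "v \<in> carrier_vec m" and i: "i < n"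
  shows "\<bar>(M *\<^sub>v v) $ i\<bar> \<le> (\<Sum>j<m. \<bar>M $$ (i, j)\<bar>) * vec_l1_norm v"
proof -
  have "\<bar>(M *\<^sub>v v) $ i\<bar> \<le> (\<Sum>j<m. \<bar>M $$ (i, j) * v $ j\<bar>)"
    unfolding index_mult_mat_vec_sum[OF M v i] by (rule sum_abs)
  also have "\<dots> \<le> (\<Sum>j<m. \<bar>M $$ (i, j)\<bar> * vec_l1_norm v)"
    using v by (intro sum_mono) (auto simp: abs_mult intro!: mult_left_mono abs_index_le_vec_l1_norm)
  finally show ?thesis by (simp add: sum_distrib_right)
qed

lemma vec_l1_norm_mult_mat_vec_le:
  assumes M: "M \<in> carrier_mat n m" and v: "v \<in> carrier_vec m"
  shows "vec_l1_norm (M *\<^sub>v v) \<le> (\<Sum>i<n. \<Sum>j<m. \<bar>M $$ (i, j)\<bar>) * vec_l1_norm v"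
proof -
  have "vec_l1_norm (M *\<^sub>v v) = (\<Sum>i<n. \<bar>(M *\<^sub>v v) $ i\<bar>)"
    using M by (simp add: vec_l1_norm_def)
  also have "\<dots> \<le> (\<Sum>i<n. (\<Sum>j<m. \<bar>M $$ (i, j)\<bar>) * vec_l1_norm v)"
    using abs_index_mult_mat_vec_le[OF M v] by (intro sum_mono) auto
  finally show ?thesis by (simp add: sum_distrib_right)
qed

lemma vec_l1_norm_mult_unit_ball_le:
  assumes M: "M \<in> carrier_mat n m" and v: "v \<in> carrier_vec m" "vec_l1_norm v \<le> 1"
  shows "vec_l1_norm (M *\<^sub>v v) \<le> (\<Sum>i<n. \<Sum>j<m. \<bar>M $$ (i, j)\<bar>)"
  using vec_l1_norm_mult_mat_vec_le[OF M v(1)]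
    mult_left_mono[OF v(2), of "\<Sum>i<n. \<Sum>j<m. \<bar>M $$ (i, j)\<bar>"]
  by (simp add: sum_nonneg)

text \<open>The exact value is the largest absolute column sum; the cruder sum over all entries
  suffices for a boundedness statement.\<close>

lemma mat_l1_norm_le:
  assumes M: "M \<in> carrier_mat n m"
  shows "mat_l1_norm M \<le> (\<Sum>i<n. \<Sum>j<m. \<bar>M $$ (i, j)\<bar>)"
  unfolding mat_l1_norm_def
proof (rule cSUP_least)
  have "0\<^sub>v m \<in> {v \<in> carrier_vec (dim_col M). vec_l1_norm v \<le> 1}"
    using M by (simp add: vec_l1_norm_def)
  then show "{v \<in> carrier_vec (dim_col M). vec_l1_norm v \<le> 1} \<noteq> {}" by blast
qed (use M vec_l1_norm_mult_unit_ball_le[OF M] in auto)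

text \<open>A real \<open>SUP\<close> dominates its members only when the set is bounded above,
  which the entry-sum bound provides.\<close>

lemma vec_l1_norm_mult_le_mat_l1_norm:
  assumes M: "M \<in> carrier_mat n m" and v: "v \<in> carrier_vec m" "vec_l1_norm v \<le> 1"
  shows "vec_l1_norm (M *\<^sub>v v) \<le> mat_l1_norm M"
  unfolding mat_l1_norm_def
proof (rule cSUP_upper)
  show "bdd_above ((\<lambda>v. vec_l1_norm (M *\<^sub>v v)) ` {v \<in> carrier_vec (dim_col M). vec_l1_norm v \<le> 1})"
    using M vec_l1_norm_mult_unit_ball_le[OF M] by (auto simp: bdd_above_def)
qed (use M v in auto)

text \<open>The norm of \<open>k \<cdot>\<^sub>m A\<close> lies between
  \<open>\<bar>k\<bar> * b\<close> and \<open>\<bar>k\<bar> * S\<close>, where \<open>b > 0\<close>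
  is the norm of the first column of \<open>A\<close> and \<open>S\<close> is the sum of its
  absolute entries.\<close>

lemma mat_l1_norm_smult_bounded_iff:
  assumes A: "A \<in> carrier_mat d d" and invA: "invertible_mat A" and d: "0 < d"
  shows "(\<exists>\<kappa>>0. \<forall>x\<in>X. \<forall>x'\<in>X. mat_l1_norm (K x x' \<cdot>\<^sub>m A) \<le> \<kappa>) \<longleftrightarrow>
    (\<exists>\<kappa>>0. \<forall>x\<in>X. \<forall>x'\<in>X. \<bar>K x x'\<bar> \<le> \<kappa>)"
proof
  assume "\<exists>\<kappa>>0. \<forall>x\<in>X. \<forall>x'\<in>X. mat_l1_norm (K x x' \<cdot>\<^sub>m A) \<le> \<kappa>"
  then obtain \<kappa> where \<kappa>: "\<kappa> > 0" "\<And>x x'. x \<in> X \<Longrightarrow> x' \<in> X \<Longrightarrow> mat_l1_norm (K x x' \<cdot>\<^sub>m A) \<le> \<kappa>"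
    by blast
  define u :: "real vec" where "u = unit_vec d 0"
  define b where "b = vec_l1_norm (A *\<^sub>v u)"
  have u: "u \<in> carrier_vec d" "vec_l1_norm u \<le> 1"
    using d by (auto simp: u_def vec_l1_norm_def unit_vec_def if_distrib sum.delta cong: if_cong)
  have "u \<noteq> 0\<^sub>v d"
    using d by (simp add: u_def)
  then have "A *\<^sub>v u \<noteq> 0\<^sub>v d"
    using u invA invertible_mat_iff_trivial_kernel[OF A] by blast
  then have b: "0 < b"
    unfolding b_def using A u by (intro vec_l1_norm_pos[of _ d]) auto
  have "\<bar>K x x'\<bar> \<le> \<kappa> / b" if "x \<in> X" "x' \<in> X" for x x'
  proof -
    have "\<bar>K x x'\<bar> * b = vec_l1_norm ((K x x' \<cdot>\<^sub>m A) *\<^sub>v u)"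
      using A u by (simp add: b_def vec_l1_norm_smult smult_mat_mult_vec)
    also have "\<dots> \<le> mat_l1_norm (K x x' \<cdot>\<^sub>m A)"
      using A u by (intro vec_l1_norm_mult_le_mat_l1_norm[of _ d d]) auto
    also have "\<dots> \<le> \<kappa>" using \<kappa> that by blast
    finally show ?thesis using b by (simp add: field_simps)
  qed
  moreover have "\<kappa> / b > 0" using \<kappa> b by simp
  ultimately show "\<exists>\<kappa>>0. \<forall>x\<in>X. \<forall>x'\<in>X. \<bar>K x x'\<bar> \<le> \<kappa>" by blast
next
  assume "\<exists>\<kappa>>0. \<forall>x\<in>X. \<forall>x'\<in>X. \<bar>K x x'\<bar> \<le> \<kappa>"
  then obtain \<kappa> where \<kappa>: "\<kappa> > 0" "\<And>x x'. x \<in> X \<Longrightarrow> x' \<in> X \<Longrightarrow> \<bar>K x x'\<bar> \<le> \<kappa>"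
    by blast
  define S where "S = (\<Sum>i<d. \<Sum>j<d. \<bar>A $$ (i, j)\<bar>)"
  have S: "0 \<le> S" by (simp add: S_def sum_nonneg)
  \<comment> \<open>The added 1 makes the bound strictly positive from \<open>0 \<le> S\<close>
    alone.\<close>
  have "mat_l1_norm (K x x' \<cdot>\<^sub>m A) \<le> \<kappa> * S + 1" if "x \<in> X" "x' \<in> X" for x x'
  proof -
    have "mat_l1_norm (K x x' \<cdot>\<^sub>m A) \<le> \<bar>K x x'\<bar> * S"
      using mat_l1_norm_le[of "K x x' \<cdot>\<^sub>m A" d d] A
      by (simp add: S_def abs_mult sum_distrib_left)
    also have "\<dots> \<le> \<kappa> * S" using \<kappa> that S by (intro mult_right_mono) auto
    finally show ?thesis by simp
  qed
  moreover have "\<kappa> * S + 1 > 0" using \<kappa> S by (simp add: add_nonneg_pos)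
  ultimately show "\<exists>\<kappa>>0. \<forall>x\<in>X. \<forall>x'\<in>X. mat_l1_norm (K x x' \<cdot>\<^sub>m A) \<le> \<kappa>" by blast
qed

section \<open>Condition (A3), coordinate by coordinate\<close>

lemma vec_sums_smult_mat_0_iff:
  assumes A: "A \<in> carrier_mat d d" and c: "\<And>j. c j \<in> carrier_vec d"
  shows "vec_sums d (\<lambda>j. (g j \<cdot>\<^sub>m A) *\<^sub>v c j) (0\<^sub>v d) \<longleftrightarrow>
    (\<forall>i<d. (\<lambda>j. g j * (A *\<^sub>v c j) $ i) sums 0)"
proof -
  have "(g j \<cdot>\<^sub>m A) *\<^sub>v c j = g j \<cdot>\<^sub>v (A *\<^sub>v c j)" for j
    using A c by (simp add: smult_mat_mult_vec)
  moreover have "A *\<^sub>v c j \<in> carrier_vec d" for j using A c by auto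
  ultimately show ?thesis using A by (auto simp: vec_sums_def)
qed

text \<open>A scalar sequence is embedded as multiples of the first unit vector. Conversely, each
  coordinate of \<open>A *\<^sub>v c j\<close> is a scalar sequence satisfying the scalar
  hypotheses; hence \<open>A *\<^sub>v c j\<close> vanishes, and so does \<open>c j\<close>.\<close>

lemma injective_on_l1_smult_iff:
  fixes x :: "nat \<Rightarrow> 'a" and K :: "'a \<Rightarrow> 'a \<Rightarrow> real"
  assumes A: "A \<in> carrier_mat d d" and invA: "invertible_mat A" and d: "0 < d"
  shows "(\<forall>c. c \<in> l1_seq d \<longrightarrow>
      (\<forall>y\<in>X. vec_sums d (\<lambda>j. (K (x j) y \<cdot>\<^sub>m A) *\<^sub>v c j) (0\<^sub>v d)) \<longrightarrow> (\<forall>j. c j = 0\<^sub>v d)) \<longleftrightarrow>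
    (\<forall>c. summable (\<lambda>j. \<bar>c j\<bar>) \<longrightarrow> (\<forall>y\<in>X. (\<lambda>j. K (x j) y * c j) sums 0) \<longrightarrow> (\<forall>j. c j = 0))"
    (is "?L \<longleftrightarrow> ?R")
proof
  assume L: ?L
  show ?R
  proof (intro allI impI)
    fix c :: "nat \<Rightarrow> real" and j
    assume c: "summable (\<lambda>j. \<bar>c j\<bar>)" "\<forall>y\<in>X. (\<lambda>j. K (x j) y * c j) sums 0"
    define u :: "real vec" where "u = unit_vec d 0"
    have u: "u \<in> carrier_vec d" "u $ 0 = 1" using d by (auto simp: u_def)
    have l1: "(\<lambda>j. c j \<cdot>\<^sub>v u) \<in> l1_seq d"
      using u summable_mult2[OF c(1), of "vec_l1_norm u"] by (simp add: l1_seq_def vec_l1_norm_smult)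
    have "vec_sums d (\<lambda>j. (K (x j) y \<cdot>\<^sub>m A) *\<^sub>v (c j \<cdot>\<^sub>v u)) (0\<^sub>v d)" if y: "y \<in> X" for y
    proof -
      have "A *\<^sub>v (c j \<cdot>\<^sub>v u) = c j \<cdot>\<^sub>v (A *\<^sub>v u)" for j
        using A u by (simp add: mult_mat_vec)
      then have "K (x j) y * (A *\<^sub>v (c j \<cdot>\<^sub>v u)) $ i = K (x j) y * c j * (A *\<^sub>v u) $ i"
        if "i < d" for i j
        using A that by simp
      \<comment> \<open>Coordinate \<open>i\<close> of the vector series is the scalar series times
        a factor independent of \<open>j\<close>.\<close>
      moreover have "(\<lambda>j. K (x j) y * c j * (A *\<^sub>v u) $ i) sums 0" for i
        using sums_mult2[OF bspec[OF c(2) y], of "(A *\<^sub>v u) $ i"] by simp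
      ultimately have sums: "\<forall>i<d. (\<lambda>j. K (x j) y * (A *\<^sub>v (c j \<cdot>\<^sub>v u)) $ i) sums 0"
        by presburger
      have uc: "c j \<cdot>\<^sub>v u \<in> carrier_vec d" for j
        using u by simp
      show ?thesis
        by (rule vec_sums_smult_mat_0_iff[THEN iffD2, OF A uc sums])
    qed
    then have "c j \<cdot>\<^sub>v u = 0\<^sub>v d" using L l1 by blast
    then have "(c j \<cdot>\<^sub>v u) $ 0 = 0" using d by simp
    then show "c j = 0" using u d by simp
  qed
next
  assume R: ?R
  show ?L
  proof (intro allI impI)
    fix c j
    assume c: "c \<in> l1_seq d" "\<forall>y\<in>X. vec_sums d (\<lambda>j. (K (x j) y \<cdot>\<^sub>m A) *\<^sub>v c j) (0\<^sub>v d)"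
    have cc: "\<And>j. c j \<in> carrier_vec d" and sc: "summable (\<lambda>j. vec_l1_norm (c j))"
      using c(1) by (auto simp: l1_seq_def)
    have "(A *\<^sub>v c j) $ i = 0" if i: "i < d" for i
    proof -
      have "summable (\<lambda>j. \<bar>(A *\<^sub>v c j) $ i\<bar>)"
        using abs_index_mult_mat_vec_le[OF A cc i]
        by (intro summable_comparison_test'[OF summable_mult[OF sc]]) auto
      moreover have "\<forall>y\<in>X. (\<lambda>j. K (x j) y * (A *\<^sub>v c j) $ i) sums 0"
      proof
        fix y assume "y \<in> X"
        with c(2) have "vec_sums d (\<lambda>j. (K (x j) y \<cdot>\<^sub>m A) *\<^sub>v c j) (0\<^sub>v d)" by blast
        from vec_sums_smult_mat_0_iff[THEN iffD1, rule_format, OF A cc this i]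
        show "(\<lambda>j. K (x j) y * (A *\<^sub>v c j) $ i) sums 0" .
      qed
      ultimately show ?thesis
        using R[rule_format, of "\<lambda>j. (A *\<^sub>v c j) $ i"] by blast
    qed
    then have "A *\<^sub>v c j = 0\<^sub>v d" using A by (auto simp: vec_eq_iff)
    then show "c j = 0\<^sub>v d"
      using cc invA invertible_mat_iff_trivial_kernel[OF A] by blast
  qed
qed

section \<open>Reduction of both notions of admissibility to scalar conditions\<close>

definition admissible_scalar_kernel :: "'a set \<Rightarrow> ('a \<Rightarrow> 'a \<Rightarrow> real) \<Rightarrow> bool" where
  "admissible_scalar_kernel X K \<longleftrightarrow>
     (\<forall>(m::nat) x. 1 \<le> m \<longrightarrow> (\<forall>j<m. x j \<in> X) \<longrightarrow> inj_on x {..<m} \<longrightarrow>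
        invertible_mat (mat m m (\<lambda>(j, k). K (x k) (x j)))) \<and>
     (\<exists>\<kappa>>0. \<forall>x\<in>X. \<forall>x'\<in>X. \<bar>K x x'\<bar> \<le> \<kappa>) \<and>
     (\<forall>x::nat \<Rightarrow> 'a. (\<forall>j. x j \<in> X) \<longrightarrow> inj x \<longrightarrow>
        (\<forall>c. summable (\<lambda>j. \<bar>c j\<bar>) \<longrightarrow> (\<forall>y\<in>X. (\<lambda>j. K (x j) y * c j) sums 0) \<longrightarrow> (\<forall>j. c j = 0)))"

text \<open>Stated for any invertible symmetric \<open>A\<close>, so that it covers both the given
  matrix and the 1 by 1 identity.\<close>

lemma admissible_multi_task_kernel_smult_iff:
  assumes A: "A \<in> carrier_mat d d" and invA: "invertible_mat A" and symA: "symmetric_mat A"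
    and d: "0 < d"
  shows "admissible_multi_task_kernel d X (\<lambda>x x'. K x x' \<cdot>\<^sub>m A) \<longleftrightarrow> admissible_scalar_kernel X K"
proof -
  have "K x x' \<cdot>\<^sub>m A \<in> carrier_mat d d \<and> symmetric_mat (K x x' \<cdot>\<^sub>m A)" for x x'
  proof -
    have "transpose_mat (K x x' \<cdot>\<^sub>m A) = K x x' \<cdot>\<^sub>m transpose_mat A"
      using A by (intro eq_matI) auto
    then show ?thesis using A symA by (simp add: symmetric_mat_def)
  qed
  moreover have "invertible_mat (kernel_block_mat d (\<lambda>x x'. K x x' \<cdot>\<^sub>m A) m x) \<longleftrightarrow>
      invertible_mat (mat m m (\<lambda>(j, k). K (x k) (x j)))" for m x
    unfolding kernel_block_mat_smult[OF A d]
    by (rule invertible_kronecker_mat_iff[OF mat_carrier A invA d])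
  ultimately show ?thesis
    unfolding admissible_multi_task_kernel_def admissible_scalar_kernel_def
    by (simp add: mat_l1_norm_smult_bounded_iff[OF A invA d]
        flip: injective_on_l1_smult_iff[OF A invA d])
qed

lemma admissible_single_task_kernel_iff:
  "admissible_single_task_kernel X K \<longleftrightarrow> admissible_scalar_kernel X K"
proof -
  have "mat 1 1 (\<lambda>_. K x x') = K x x' \<cdot>\<^sub>m 1\<^sub>m 1" for x x'
    by (rule eq_matI) auto
  moreover have "symmetric_mat (1\<^sub>m 1)"
    by (simp add: symmetric_mat_def)
  moreover have "invertible_mat (1\<^sub>m 1 :: real mat)"
    by (simp add: invertible_mat_iff_trivial_kernel[of _ 1])
  ultimately show ?thesis
    unfolding admissible_single_task_kernel_def
    using admissible_multi_task_kernel_smult_iff[of "1\<^sub>m 1" 1 X K] by simp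
qed

text \<open>If \<open>A *\<^sub>v v\<close> is zero, then the quadratic form vanishes at
  \<open>v\<close>, which strict positivity allows only for the zero vector.\<close>

lemma strict_pos_def_mat_invertible:
  assumes A: "A \<in> carrier_mat d d" and "strict_pos_def_mat A"
  shows "invertible_mat A"
  using assms by (fastforce simp: invertible_mat_iff_trivial_kernel[OF A] strict_pos_def_mat_def)

theorem theorem4p1:
  fixes X :: "'a set" and d :: nat and K :: "'a \<Rightarrow> 'a \<Rightarrow> real" and A :: "real mat"
  assumes "X \<noteq> {}"
    and "1 \<le> d"
    and "pos_def_kernel X K"
    and "A \<in> carrier_mat d d"
    and "symmetric_mat A"
    and "strict_pos_def_mat A"
  shows "admissible_multi_task_kernel d X (\<lambda>x x'. K x x' \<cdot>\<^sub>m A) \<longleftrightarrow>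
         admissible_single_task_kernel X K"
  using assms admissible_multi_task_kernel_smult_iff[of A d X K] strict_pos_def_mat_invertible[of A d]
  by (simp add: admissible_single_task_kernel_iff)

end
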